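(* Let $\mathbf d\in\mathbb{N}_0^n$, $h_1,\ldots,h_r\in\mathbb{Z}[x_1,\ldots,x_n]_{\le\mathbf d}$, $p_1,\ldots,p_r\in\mathbb{Z}_{\ge2}$, and $k=\lceil\log_2(\mathrm{lcm}(p_1,\ldots,p_r))\rceil$. Let $\mathcal X=\{\mathbf x\in\mathbb{Z}^r: p_1\mid x_1,\ldots,p_r\mid x_r\}$ and $\mathbf h=(h_1,\ldots,h_r):\mathbb{R}^n\to\mathbb{R}^r$. Let $\mathbf d'\in\mathbb{N}_0^n$ be a multi-degree such that for every $\mathbf d''\ge\mathbf d'$ and every non-empty box $D_{\mathbf l,\mathbf k'}$ the following are equivalent: (i) the $\mathbf d''$-matrix $w$ of $(h_1,\ldots,h_r)$ over $D_{\mathbf l,\mathbf k'}$, with columns $w_1,\ldots,w_r$, satisfies that hasSol$(\min(w_i),\max(w_i),p_i)$ is True for all $1\le i\le r$; (ii) $D_{\mathbf l,\mathbf k'}\cap\mathbf h^{-1}(\mathcal X)\ne\emptyset$; (iii) there is $D_{\mathbf l',\mathbf 0}\subseteq D_{\mathbf l,\mathbf k'}$ with $D_{\mathbf l',\mathbf 0}\cap\mathbf h^{-1}(\mathcal X)\ne\emptyset$. Then the expected number (in the branching-process model described in the context) of matrix multiplications produced by SolveCE in $D=\prod_{i=1}^n[0,2^k]$ is \[ \sum_{i=0}^{nk}2^i\prod_{j=0}^{i-1}\left(1-(1-\lambda)^{2^{nk-j}}\right)-1,\qquad \lambda:=\frac{\#\{\mathbf l: D_{\mathbf l,\mathbf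 0}\cap\mathbf h^{-1}(\mathcal X)\neq\emptyset\}}{2^{nk}}. \] The number $\lambda$ is the probability of a box $D_{\mathbf l,\mathbf 0}$ to intersect $\mathbf h^{-1}(\mathcal X)$.
   Context: $\mathbb{Z}[x_1,\ldots,x_n]_{\le\mathbf d}$: polynomials of degree at most $d_i$ in $x_i$. The $\mathbf d$-Bernstein basis of $\mathbb{R}[\mathbf x]_{\le\mathbf d}$ consists of $\prod_i\binom{d_i}{k_i}x_i^{k_i}(1-x_i)^{d_i-k_i}$, $\mathbf 0\le\mathbf k\le\mathbf d$, in lexicographic order. For a box $E=\prod_i[\alpha_i,\beta_i]$ put $\varphi_E(\mathbf x)=(\alpha_i+(\beta_i-\alpha_i)x_i)_i$; the $\mathbf d$-matrix of $(h_1,\ldots,h_r)$ over $E$ has as $i$-th column the coordinate vector of $h_i\circ\varphi_E$ in the $\mathbf d$-Bernstein basis. $M_j^L$ (resp. $M_j^R$) is the matrix in the $\mathbf d$-Bernstein basis (acting on column vectors) of $q\mapsto q\circ\varphi_E$ for $E=[0,1]^{j-1}\times[0,1/2]\times[0,1]^{n-j}$ (resp. $E=[0,1]^{j-1}\times[1/2,1]\times[0,1]^{n-j}$). For $\mathbf k'\in\mathbb{N}_0^n$ with $0\le k_i'\le k$ and integers $0\le l_i<2^{k-k_i'}$, $D_{\mathbf l,\mathbf k'}=\prod_{i=1}^n[l_i2^{k_i'},(l_i+1)2^{k_i'}]$; for other $(\mathbf l,\mathbf k')$, $D_{\mathbf l,\mathbf k'}=\emptyset$. hasSol$(m_1,m_2,p)$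 for rationals $m_1\le m_2$ and $p\in\mathbb{Z}_{\ge2}$: replace $(m_1,m_2)$ by $(\lceil m_1\rceil,\lfloor m_2\rfloor)$; let $r_1,r_2\in\{0,\ldots,p-1\}$ be their remainders modulo $p$; return False if $m_2-m_1<p-1$ and $0<r_1\le r_2$, and True otherwise. SolveCE$(\mathbf p,w,\mathbf k',\mathbf l)$, with a global set $\mathcal S'$ initially empty, started at $(\mathbf p,v,(k,\ldots,k),\mathbf 0)$ with $v$ the matrix of $(h_1,\ldots,h_r)$ over $D$ in the Bernstein basis of the multi-degree used (here $\mathbf d'$): if hasSol$(\min(w_i),\max(w_i),p_i)$ is False for some $i$, the box $D_{\mathbf l,\mathbf k'}$ is rejected. Otherwise let $j$ be an index with $k_j'=\max(\mathbf k')$; if $k_j'>0$ the box is subdivided by calling SolveCE$(\mathbf p,M_j^Lw,\mathbf k'-e_j,\mathbf l+l_je_j)$ and SolveCE$(\mathbf p,M_j^Rw,\mathbf k'-e_j,\mathbf l+l_je_j+e_j)$ (two matrix multiplications; $e_j$ is the $j$-th canonical vector); if $\mathbf k'=\mathbf 0$, add $\mathbf l$ to $\mathcal S'$ when $p_i\mid w_{1i}$ for all $i$. The number of matrix multiplications equals the number of boxes processed (function calls) minus $1$. Probabilistic model for "expected number". A box $D_{\mathbf l,\mathbf k'}$ is in generation $i$ if $k_1'+\cdots+k_n'=nk-i$; the initial box $D$ is generation $0$. A box in generation $i$ contains $2^{nk-i}$ unit boxes; it is rejected (adding no box to generation $i+1$) with probability $(1-\lambda)^{2^{nk-i}}$ and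 is subdivided (adding two boxes to generation $i+1$) with probability $\lambda_i=1-(1-\lambda)^{2^{nk-i}}$, independently of the other boxes. Thus the numbers $Z_i$ of boxes in generation $i$ ($0\le i\le nk$) form a branching process: $Z_0=1$, and $Z_{i+1}$ is the sum of $Z_i$ independent random variables with probability generating function $1-\lambda_i+\lambda_ix^2$. The expected number of boxes processed is $E(Z_0)+\cdots+E(Z_{nk})$ and the expected number of matrix multiplications is this number minus $1$. *)

theory Defs
  imports
    "HOL-Probability.Probability"
    "HOL-Library.Poly_Mapping"
    "Jordan_Normal_Form.Matrix"
begin

unbundle no vec_syntax

text \<open>Vectors and matrices are those of Jordan_Normal_Form; indices start at 0. The number of
  variables \<open>n\<close> is carried as the dimension of the multi-index or of the point.\<close>

text \<open>A polynomial over the integers in the variables \<open>0, 1, 2, \<dots>\<close>: a finitely supported map from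
  monomials (finitely supported exponent maps) to coefficients.\<close>

type_synonym int_mpoly = "(nat \<Rightarrow>\<^sub>0 nat) \<Rightarrow>\<^sub>0 int"

definition int_polys_le :: "nat vec \<Rightarrow> int_mpoly set" where
  "int_polys_le d = {q. \<forall>m \<in> Poly_Mapping.keys q.
     Poly_Mapping.keys m \<subseteq> {..<dim_vec d} \<and> (\<forall>i<dim_vec d. Poly_Mapping.lookup m i \<le> d $ i)}"

definition peval :: "int_mpoly \<Rightarrow> real vec \<Rightarrow> real" where
  "peval q x = (\<Sum>m \<in> Poly_Mapping.keys q. of_int (Poly_Mapping.lookup q m) *
     (\<Prod>i \<in> Poly_Mapping.keys m. (x $ i) ^ Poly_Mapping.lookup m i))"

text \<open>All multi-indices between \<open>0\<close> and \<open>d\<close>, in lexicographic order.\<close>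

definition lex_indices :: "nat vec \<Rightarrow> nat vec list" where
  "lex_indices d = map vec_of_list (product_lists (map (\<lambda>e. [0..<Suc e]) (list_of_vec d)))"

definition bernstein :: "nat vec \<Rightarrow> nat vec \<Rightarrow> real vec \<Rightarrow> real" where
  "bernstein d \<kappa> x = (\<Prod>i<dim_vec d.
     real ((d $ i) choose (\<kappa> $ i)) * (x $ i) ^ (\<kappa> $ i) * (1 - x $ i) ^ (d $ i - \<kappa> $ i))"

text \<open>Real polynomials are identified with the functions they define. The coordinate vector is
  meaningful only if \<open>q\<close> is a polynomial function of multi-degree at most \<open>d\<close>.\<close>

definition bernstein_coords :: "nat vec \<Rightarrow> (real vec \<Rightarrow> real) \<Rightarrow> real vec" where
  "bernstein_coords d q = (THE v. v \<in> carrier_vec (length (lex_indices d)) \<and>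
     (\<forall>x \<in> carrier_vec (dim_vec d).
        q x = (\<Sum>a<length (lex_indices d). v $ a * bernstein d (lex_indices d ! a) x)))"

text \<open>The affine map from the unit cube to the box with lower corner \<open>\<alpha>\<close> and upper corner \<open>\<beta>\<close>.\<close>

definition box_map :: "real vec \<Rightarrow> real vec \<Rightarrow> real vec \<Rightarrow> real vec" where
  "box_map \<alpha> \<beta> x = vec (dim_vec \<alpha>) (\<lambda>i. \<alpha> $ i + (\<beta> $ i - \<alpha> $ i) * x $ i)"

definition d_matrix ::
  "nat vec \<Rightarrow> nat \<Rightarrow> (nat \<Rightarrow> int_mpoly) \<Rightarrow> real vec \<Rightarrow> real vec \<Rightarrow> real mat" where
  "d_matrix d r h \<alpha> \<beta> = mat (length (lex_indices d)) r
     (\<lambda>(a, i). bernstein_coords d (peval (h i) \<circ> box_map \<alpha> \<beta>) $ a)"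

text \<open>Column \<open>b\<close> holds the coordinates of the image of the \<open>b\<close>-th basis polynomial.\<close>

definition subst_matrix :: "nat vec \<Rightarrow> real vec \<Rightarrow> real vec \<Rightarrow> real mat" where
  "subst_matrix d \<alpha> \<beta> = mat (length (lex_indices d)) (length (lex_indices d))
     (\<lambda>(a, b). bernstein_coords d (bernstein d (lex_indices d ! b) \<circ> box_map \<alpha> \<beta>) $ a)"

definition left_matrix :: "nat vec \<Rightarrow> nat \<Rightarrow> real mat" where
  "left_matrix d j = subst_matrix d (vec (dim_vec d) (\<lambda>i. 0))
     (vec (dim_vec d) (\<lambda>i. if i = j then 1/2 else 1))"

definition right_matrix :: "nat vec \<Rightarrow> nat \<Rightarrow> real mat" where
  "right_matrix d j = subst_matrix d (vec (dim_vec d) (\<lambda>i. if i = j then 1/2 else 0))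
     (vec (dim_vec d) (\<lambda>i. 1))"

definition box_lo :: "nat vec \<Rightarrow> nat vec \<Rightarrow> real vec" where
  "box_lo l \<kappa> = vec (dim_vec l) (\<lambda>i. real (l $ i * 2 ^ (\<kappa> $ i)))"

definition box_hi :: "nat vec \<Rightarrow> nat vec \<Rightarrow> real vec" where
  "box_hi l \<kappa> = vec (dim_vec l) (\<lambda>i. real ((l $ i + 1) * 2 ^ (\<kappa> $ i)))"

definition dbox :: "nat \<Rightarrow> nat \<Rightarrow> nat vec \<Rightarrow> nat vec \<Rightarrow> real vec set" where
  "dbox n k l \<kappa> =
     (if l \<in> carrier_vec n \<and> \<kappa> \<in> carrier_vec n \<and> (\<forall>i<n. \<kappa> $ i \<le> k \<and> l $ i < 2 ^ (k - \<kappa> $ i))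
      then {x \<in> carrier_vec n. \<forall>i<n. box_lo l \<kappa> $ i \<le> x $ i \<and> x $ i \<le> box_hi l \<kappa> $ i}
      else {})"

definition target_set :: "nat \<Rightarrow> (nat \<Rightarrow> int) \<Rightarrow> real vec set" where
  "target_set r p = {y \<in> carrier_vec r. \<forall>i<r. \<exists>z::int. y $ i = of_int z \<and> p i dvd z}"

definition sol_set :: "nat \<Rightarrow> nat \<Rightarrow> (nat \<Rightarrow> int_mpoly) \<Rightarrow> (nat \<Rightarrow> int) \<Rightarrow> real vec set" where
  "sol_set n r h p = {x \<in> carrier_vec n. vec r (\<lambda>i. peval (h i) x) \<in> target_set r p}"

definition unit_density ::
  "nat \<Rightarrow> nat \<Rightarrow> nat \<Rightarrow> (nat \<Rightarrow> int_mpoly) \<Rightarrow> (nat \<Rightarrow> int) \<Rightarrow> real" where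
  "unit_density n k r h p =
     real (card {l. dbox n k l (0\<^sub>v n) \<inter> sol_set n r h p \<noteq> {}}) / 2 ^ (n * k)"

text \<open>The arguments are rational in all uses. The rounded interval may be empty; the test is then
  evaluated on the remainders all the same.\<close>

definition hasSol :: "real \<Rightarrow> real \<Rightarrow> int \<Rightarrow> bool" where
  "hasSol m1 m2 p =
     (let c1 = \<lceil>m1\<rceil>; c2 = \<lfloor>m2\<rfloor>
      in \<not> (c2 - c1 < p - 1 \<and> 0 < c1 mod p \<and> c1 mod p \<le> c2 mod p))"

definition all_hasSol :: "(nat \<Rightarrow> int) \<Rightarrow> real mat \<Rightarrow> bool" where
  "all_hasSol p w = (\<forall>i<dim_col w.
     hasSol (Min (set\<^sub>v (col w i))) (Max (set\<^sub>v (col w i))) (p i))"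

text \<open>Big-step semantics: \<open>SolveCE d p w \<kappa> l B R m S\<close> says that the call on the box \<open>(l, \<kappa>)\<close> can
  process exactly the boxes in the list \<open>B\<close> (one entry per function call), reject those in \<open>R\<close>,
  perform \<open>m\<close> matrix multiplications, and add the elements of \<open>S\<close> to the global solution set.
  It is a relation since any index at which \<open>\<kappa>\<close> is maximal may be chosen for the subdivision.\<close>

inductive SolveCE ::
  "nat vec \<Rightarrow> (nat \<Rightarrow> int) \<Rightarrow> real mat \<Rightarrow> nat vec \<Rightarrow> nat vec \<Rightarrow>
   (nat vec \<times> nat vec) list \<Rightarrow> (nat vec \<times> nat vec) set \<Rightarrow> nat \<Rightarrow> nat vec set \<Rightarrow> bool"
  for d :: "nat vec" and p :: "nat \<Rightarrow> int" where
  reject: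
    "\<not> all_hasSol p w \<Longrightarrow> SolveCE d p w \<kappa> l [(l, \<kappa>)] {(l, \<kappa>)} 0 {}"
| subdivide:
    "\<lbrakk> all_hasSol p w;
       j < dim_vec \<kappa>; \<forall>i<dim_vec \<kappa>. \<kappa> $ i \<le> \<kappa> $ j; 0 < \<kappa> $ j;
       e = unit_vec (dim_vec \<kappa>) j;
       SolveCE d p (left_matrix d j * w) (\<kappa> - e) (l + (l $ j) \<cdot>\<^sub>v e) B R m S;
       SolveCE d p (right_matrix d j * w) (\<kappa> - e) (l + (l $ j) \<cdot>\<^sub>v e + e) B' R' m' S' \<rbrakk>
     \<Longrightarrow> SolveCE d p w \<kappa> l ((l, \<kappa>) # B @ B') (R \<union> R') (2 + m + m') (S \<union> S')"
| unit_box: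
    "\<lbrakk> all_hasSol p w; \<kappa> = 0\<^sub>v (dim_vec \<kappa>) \<rbrakk>
     \<Longrightarrow> SolveCE d p w \<kappa> l [(l, \<kappa>)] {} 0
           (if \<forall>i<dim_col w. \<exists>z::int. w $$ (0, i) = of_int z \<and> p i dvd z then {l} else {})"

text \<open>\<open>X i j\<close> is the number of boxes (0 or 2) that the \<open>j\<close>-th box of generation \<open>i\<close> adds to
  generation \<open>i + 1\<close>, so its probability generating function is \<open>1 - \<lambda>\<^sub>i + \<lambda>\<^sub>i x\<^sup>2\<close> where
  \<open>\<lambda>\<^sub>i = 1 - (1 - lam) ^ 2 ^ (N - i)\<close>. \<open>N\<close> is the index of the last generation, \<open>n * k\<close>. All the
  \<open>X i j\<close> are jointly independent, hence those of generation \<open>i\<close> are independent of \<open>Z i\<close>.\<close>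

definition branching_model :: "'a measure \<Rightarrow> nat \<Rightarrow> real \<Rightarrow> (nat \<Rightarrow> 'a \<Rightarrow> nat) \<Rightarrow> bool" where
  "branching_model M N lam Z \<longleftrightarrow> prob_space M \<and>
     (\<exists>X :: nat \<Rightarrow> nat \<Rightarrow> 'a \<Rightarrow> nat.
        prob_space.indep_vars M (\<lambda>_. count_space UNIV) (\<lambda>(i, j). X i j) ({..<N} \<times> UNIV) \<and>
        (\<forall>i<N. \<forall>j.
           measure M {\<omega> \<in> space M. X i j \<omega> = 0} = (1 - lam) ^ 2 ^ (N - i) \<and>
           measure M {\<omega> \<in> space M. X i j \<omega> = 2} = 1 - (1 - lam) ^ 2 ^ (N - i)) \<and>
        (\<forall>\<omega> \<in> space M. Z 0 \<omega> = 1) \<and>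
        (\<forall>i<N. \<forall>\<omega> \<in> space M. Z (Suc i) \<omega> = (\<Sum>j<Z i \<omega>. X i j \<omega>)))"

definition expected_boxes :: "'a measure \<Rightarrow> nat \<Rightarrow> (nat \<Rightarrow> 'a \<Rightarrow> nat) \<Rightarrow> real" where
  "expected_boxes M N Z = (\<Sum>i\<le>N. prob_space.expectation M (\<lambda>\<omega>. real (Z i \<omega>)))"

definition expected_mults :: "'a measure \<Rightarrow> nat \<Rightarrow> (nat \<Rightarrow> 'a \<Rightarrow> nat) \<Rightarrow> real" where
  "expected_mults M N Z = expected_boxes M N Z - 1"

end

theory Submission
  imports Defs
begin

text \<open>
  The three claims are independent of each other.

  The expected number of multiplications is a statement about the branching process alone. Each of
  the \<open>Z i\<close> boxes of generation \<open>i\<close> contributes 2 boxes with probability \<open>\<lambda>\<^sub>i = 1 - (1 - \<lambda>) ^ 2 ^ (n k - i)\<close>, and \<open>Z i\<close> is a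
  function of the offspring counts of earlier generations, hence independent of these contributions. So
  \<open>E (Z (i + 1)) = 2 \<lambda>\<^sub>i E (Z i)\<close> (\<open>expectation_branching_step\<close>), and the products in the formula
  are these recurrences unrolled.

  That \<open>\<lambda>\<close> is a probability amounts to counting: there are \<open>(2 ^ k) ^ n\<close> unit boxes.

  The third claim ties the model to the algorithm. Its counter is right since every subdivision
  costs two multiplications and opens two boxes. Its rejections are right once the matrix that a
  call receives is known to be the matrix of \<open>h\<close> over the box of that call, for then the hypothesis
  on \<open>d'\<close> translates the rejection test into the absence of solutions. The matrix stays correct
  along the recursion because \<open>left_matrix\<close> and \<open>right_matrix\<close> represent substitutions that halve
  the unit cube (\<open>subst_matrix_mult_d_matrix\<close>). Since coordinates are described as the unique
  vector with the right expansion, this needs the fact that the Bernstein polynomials form a basis: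
  in one variable every product of \<open>N\<close> affine factors is a combination of them, and the substitution
  \<open>t = s / (1 + s)\<close> turns a linear relation between them into a polynomial with infinitely many zeros. Both
  properties pass to tensor products, which gives the multivariate basis.
\<close>

section \<open>The Bernstein basis in one variable\<close>

definition bernstein1 :: "nat \<Rightarrow> nat \<Rightarrow> real \<Rightarrow> real" where
  "bernstein1 N k t = real (N choose k) * t ^ k * (1 - t) ^ (N - k)"

text \<open>In terms of \<open>t\<close> and \<open>1 - t\<close> every affine factor is homogeneous,
  \<open>a + b t = (a + b) t + a (1 - t)\<close>. Multiplication by it therefore raises the degree of a form in
  \<open>t\<close> and \<open>1 - t\<close> by one, and the binomial coefficients are nonzero scalings.\<close>

lemma bernstein1_span_linear_factor:
  assumes "\<And>t. f t = (\<Sum>k\<le>N. c k * bernstein1 N k t)"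
  shows "\<exists>c'. \<forall>t. (a + b * t) * f t = (\<Sum>k\<le>Suc N. c' k * bernstein1 (Suc N) k t)"
proof -
  define e where "e k = c k * real (N choose k)" for k
  \<comment> \<open>The coefficients of the product with respect to the unscaled basis.\<close>
  define g where "g k = (if k = 0 then 0 else (a + b) * e (k - 1)) + (if k \<le> N then a * e k else 0)" for k
  define c' where "c' k = g k / real (Suc N choose k)" for k
  have "(a + b * t) * f t = (\<Sum>k\<le>Suc N. c' k * bernstein1 (Suc N) k t)" for t
  proof -
    have f: "f t = (\<Sum>k\<le>N. e k * (t ^ k * (1 - t) ^ (N - k)))"
      by (simp add: assms e_def bernstein1_def mult_ac)
    have "(\<Sum>k\<le>Suc N. c' k * bernstein1 (Suc N) k t) = (\<Sum>k\<le>Suc N. g k * (t ^ k * (1 - t) ^ (Suc N - k)))"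
    proof (rule sum.cong[OF refl])
      fix k assume "k \<in> {..Suc N}"
      then have "real (Suc N choose k) \<noteq> 0" by (simp del: binomial_Suc_Suc)
      then show "c' k * bernstein1 (Suc N) k t = g k * (t ^ k * (1 - t) ^ (Suc N - k))"
        by (simp add: c'_def bernstein1_def del: binomial_Suc_Suc)
    qed
    also have "\<dots> = (\<Sum>k\<le>Suc N. (if k = 0 then 0 else (a + b) * e (k - 1)) * (t ^ k * (1 - t) ^ (Suc N - k)))
        + (\<Sum>k\<le>Suc N. (if k \<le> N then a * e k else 0) * (t ^ k * (1 - t) ^ (Suc N - k)))"
      by (simp only: g_def distrib_right sum.distrib)
    also have "(\<Sum>k\<le>Suc N. (if k = 0 then 0 else (a + b) * e (k - 1)) * (t ^ k * (1 - t) ^ (Suc N - k)))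
        = (a + b) * t * f t"
      unfolding f sum.atMost_Suc_shift sum_distrib_left by (simp add: mult_ac)
    also have "(\<Sum>k\<le>Suc N. (if k \<le> N then a * e k else 0) * (t ^ k * (1 - t) ^ (Suc N - k)))
        = a * (1 - t) * f t"
      unfolding f sum_distrib_left by (simp add: Suc_diff_le mult_ac)
    finally show ?thesis by (simp add: algebra_simps)
  qed
  then show ?thesis by blast
qed

text \<open>Two affine bases suffice for both applications: a power \<open>(\<alpha> + \<delta> t) ^ m\<close> is brought up to degree
  \<open>N\<close> by powers of the constant 1, and a Bernstein polynomial composed with an affine map is, up to
  a scalar, of this form as it stands.\<close>

lemma bernstein1_span_powers:
  assumes "m + m' = N"
  shows "\<exists>c. \<forall>t. (a + b * t) ^ m * (a' + b' * t) ^ m' = (\<Sum>k\<le>N. c k * bernstein1 N k t)"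
  using assms
proof (induction N arbitrary: m m')
  case 0
  then show ?case by (auto simp: bernstein1_def intro!: exI[of _ "\<lambda>_. 1"])
next
  case (Suc N)
  show ?case
  proof (cases m)
    case 0
    then obtain j where j: "m' = Suc j" "m + j = N" using Suc.prems by (cases m') auto
    from Suc.IH[OF j(2)] obtain c where
      "\<And>t. (a + b * t) ^ m * (a' + b' * t) ^ j = (\<Sum>k\<le>N. c k * bernstein1 N k t)" by blast
    from bernstein1_span_linear_factor[where f="\<lambda>t. (a + b * t) ^ m * (a' + b' * t) ^ j", OF this, of a' b']
    show ?thesis by (simp add: j mult_ac)
  next
    case (Suc j)
    then have "j + m' = N" using Suc.prems by simp
    from Suc.IH[OF this] obtain c where
      "\<And>t. (a + b * t) ^ j * (a' + b' * t) ^ m' = (\<Sum>k\<le>N. c k * bernstein1 N k t)" by blast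
    from bernstein1_span_linear_factor[where f="\<lambda>t. (a + b * t) ^ j * (a' + b' * t) ^ m'", OF this, of a b]
    show ?thesis by (simp add: \<open>m = Suc j\<close> mult_ac)
  qed
qed

text \<open>For \<open>t = s / (1 + s)\<close> one has \<open>1 - t = 1 / (1 + s)\<close>, so multiplication by \<open>(1 + s) ^ N\<close> turns
  \<open>t ^ k * (1 - t) ^ (N - k)\<close> into \<open>s ^ k\<close>.\<close>

lemma bernstein1_independent:
  assumes "\<And>t. (\<Sum>k\<le>N. c k * bernstein1 N k t) = 0" and "k \<le> N"
  shows "c k = 0"
proof -
  define e where "e k = c k * real (N choose k)" for k
  have "(\<Sum>k\<le>N. e k * s ^ k) = 0" if "s > 0" for s
  proof -
    define t where "t = s / (1 + s)"
    have t: "1 - t = 1 / (1 + s)" using that by (simp add: t_def field_simps)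
    have "0 = (1 + s) ^ N * (\<Sum>k\<le>N. c k * bernstein1 N k t)" using assms(1) by simp
    also have "\<dots> = (\<Sum>k\<le>N. e k * s ^ k)"
      unfolding sum_distrib_left
    proof (rule sum.cong[OF refl])
      fix k assume "k \<in> {..N}"
      then have "(1 + s) ^ N = (1 + s) ^ k * (1 + s) ^ (N - k)"
        by (simp flip: power_add)
      then show "(1 + s) ^ N * (c k * bernstein1 N k t) = e k * s ^ k"
        using that unfolding bernstein1_def e_def t by (simp add: t_def power_divide)
    qed
    finally show ?thesis by simp
  qed
  then have "{0<..} \<subseteq> {s. (\<Sum>k\<le>N. e k * s ^ k) = 0}" by auto
  then have "\<not> finite {s. (\<Sum>k\<le>N. e k * s ^ k) = 0}"
    using finite_subset infinite_Ioi by blast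
  then have "e k = 0" using polyfun_finite_roots[of e N] assms(2) by blast
  then show ?thesis using assms(2) by (simp add: e_def)
qed

section \<open>The Bernstein basis in several variables\<close>

text \<open>Fixing all coordinates but one makes a vanishing combination a relation between the functions
  of the remaining coordinate. By their independence its coefficients vanish. These are again
  combinations, over one coordinate less, so induction on the set of coordinates applies.\<close>

lemma tensor_independent:
  fixes f :: "'i \<Rightarrow> 'k \<Rightarrow> real \<Rightarrow> real"
  assumes "finite I" and "\<And>i. i \<in> I \<Longrightarrow> finite (K i)"
    and "\<And>i c k. i \<in> I \<Longrightarrow> (\<And>t. (\<Sum>k\<in>K i. c k * f i k t) = 0) \<Longrightarrow> k \<in> K i \<Longrightarrow> c k = 0"
    and "\<And>x. (\<Sum>\<kappa>\<in>Pi\<^sub>E I K. v \<kappa> * (\<Prod>i\<in>I. f i (\<kappa> i) (x i))) = 0"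
    and "\<kappa> \<in> Pi\<^sub>E I K"
  shows "v \<kappa> = 0"
  using assms
proof (induction I arbitrary: v \<kappa> rule: finite_induct)
  case empty
  then show ?case by simp
next
  case (insert i I)
  have inj: "inj_on (\<lambda>(y, g). g(i := y)) (K i \<times> Pi\<^sub>E I K)"
    using insert.hyps(2) by (rule inj_combinator)
  have split: "(\<Sum>\<kappa>\<in>Pi\<^sub>E (insert i I) K. v \<kappa> * (\<Prod>i\<in>insert i I. f i (\<kappa> i) (x i))) =
      (\<Sum>k\<in>K i. (\<Sum>g\<in>Pi\<^sub>E I K. v (g(i := k)) * (\<Prod>j\<in>I. f j (g j) (x j))) * f i k (x i))" for x
  proof -
    have "(\<Sum>\<kappa>\<in>Pi\<^sub>E (insert i I) K. v \<kappa> * (\<Prod>i\<in>insert i I. f i (\<kappa> i) (x i))) =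
       (\<Sum>(k, g)\<in>K i \<times> Pi\<^sub>E I K. v (g(i := k)) * (\<Prod>j\<in>insert i I. f j ((g(i := k)) j) (x j)))"
      unfolding PiE_insert_eq sum.reindex[OF inj] by (simp only: case_prod_unfold comp_def)
    also have "\<dots> = (\<Sum>(k, g)\<in>K i \<times> Pi\<^sub>E I K. v (g(i := k)) * (\<Prod>j\<in>I. f j (g j) (x j)) * f i k (x i))"
    proof (rule sum.cong[OF refl], clarify)
      fix k g
      have "(\<Prod>j\<in>I. f j ((g(i := k)) j) (x j)) = (\<Prod>j\<in>I. f j (g j) (x j))"
        using insert.hyps by (intro prod.cong) auto
      then show "v (g(i := k)) * (\<Prod>j\<in>insert i I. f j ((g(i := k)) j) (x j)) =
          v (g(i := k)) * (\<Prod>j\<in>I. f j (g j) (x j)) * f i k (x i)"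
        using insert.hyps by simp
    qed
    finally show ?thesis by (simp add: sum.cartesian_product sum_distrib_right)
  qed
  have "v (g(i := k)) = 0" if "g \<in> Pi\<^sub>E I K" "k \<in> K i" for g k
  proof (rule insert.IH[of "\<lambda>g. v (g(i := k))"])
    fix x
    show "(\<Sum>g\<in>Pi\<^sub>E I K. v (g(i := k)) * (\<Prod>j\<in>I. f j (g j) (x j))) = 0"
    proof (rule insert.prems(2)[of i "\<lambda>k. \<Sum>g\<in>Pi\<^sub>E I K. v (g(i := k)) * (\<Prod>j\<in>I. f j (g j) (x j))"])
      fix t
      have "(\<Prod>j\<in>I. f j (g j) ((x(i := t)) j)) = (\<Prod>j\<in>I. f j (g j) (x j))" for g
        using insert.hyps by (intro prod.cong) auto
      then show "(\<Sum>k\<in>K i. (\<Sum>g\<in>Pi\<^sub>E I K. v (g(i := k)) * (\<Prod>j\<in>I. f j (g j) (x j))) * f i k t) = 0"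
        using split[of "x(i := t)"] insert.prems(3)[of "x(i := t)"] by simp
    qed (use that in auto)
  next
    fix j c k' assume "j \<in> I" "\<And>t. (\<Sum>k\<in>K j. c k * f j k t) = 0" "k' \<in> K j"
    then show "c k' = 0" using insert.prems(2)[of j c k'] by blast
  qed (use that insert.prems(1) in auto)
  moreover have "\<kappa> = (\<kappa>(i := undefined))(i := \<kappa> i)" "\<kappa>(i := undefined) \<in> Pi\<^sub>E I K" "\<kappa> i \<in> K i"
    using insert.prems(4) insert.hyps by (auto simp: PiE_iff extensional_def)
  ultimately show ?case by metis
qed

definition multi_indices :: "nat vec \<Rightarrow> (nat \<Rightarrow> nat) set" where
  "multi_indices d = (\<Pi>\<^sub>E i\<in>{..<dim_vec d}. {..d $ i})"

definition tensor_bernstein :: "nat vec \<Rightarrow> (nat \<Rightarrow> nat) \<Rightarrow> real vec \<Rightarrow> real" where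
  "tensor_bernstein d \<kappa> x = (\<Prod>i<dim_vec d. bernstein1 (d $ i) (\<kappa> i) (x $ i))"

lemma finite_multi_indices [simp]: "finite (multi_indices d)"
  by (simp add: multi_indices_def finite_PiE)

lemma tensor_bernstein_independent:
  assumes "\<And>x. x \<in> carrier_vec (dim_vec d) \<Longrightarrow> (\<Sum>\<kappa>\<in>multi_indices d. v \<kappa> * tensor_bernstein d \<kappa> x) = 0"
    and "\<kappa> \<in> multi_indices d"
  shows "v \<kappa> = 0"
proof (rule tensor_independent[of "{..<dim_vec d}" "\<lambda>i. {..d $ i}" "\<lambda>i. bernstein1 (d $ i)" v])
  fix i c k
  assume "\<And>t. (\<Sum>k\<le>d $ i. c k * bernstein1 (d $ i) k t) = 0" "k \<in> {..d $ i}"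
  then show "c k = 0" using bernstein1_independent by auto
next
  fix x :: "nat \<Rightarrow> real"
  show "(\<Sum>\<kappa>\<in>Pi\<^sub>E {..<dim_vec d} (\<lambda>i. {..d $ i}). v \<kappa> * (\<Prod>i<dim_vec d. bernstein1 (d $ i) (\<kappa> i) (x i))) = 0"
    using assms(1)[of "vec (dim_vec d) x"] by (simp add: tensor_bernstein_def multi_indices_def)
qed (use assms(2) in \<open>auto simp: multi_indices_def\<close>)

definition bernstein_span :: "nat vec \<Rightarrow> (real vec \<Rightarrow> real) \<Rightarrow> bool" where
  "bernstein_span d q \<longleftrightarrow> (\<exists>c. \<forall>x\<in>carrier_vec (dim_vec d).
     q x = (\<Sum>\<kappa>\<in>multi_indices d. c \<kappa> * tensor_bernstein d \<kappa> x))"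

text \<open>Expanding a product of univariate combinations distributively gives a combination of tensor
  products.\<close>

lemma bernstein_span_prod:
  assumes "\<And>i. i < dim_vec d \<Longrightarrow> \<exists>c. \<forall>t. g i t = (\<Sum>k\<le>d $ i. c k * bernstein1 (d $ i) k t)"
  shows "bernstein_span d (\<lambda>x. \<Prod>i<dim_vec d. g i (x $ i))"
proof -
  obtain c where c: "\<And>i t. i < dim_vec d \<Longrightarrow> g i t = (\<Sum>k\<le>d $ i. c i k * bernstein1 (d $ i) k t)"
    using assms by metis
  have "(\<Prod>i<dim_vec d. g i (x $ i)) =
      (\<Sum>\<kappa>\<in>multi_indices d. (\<Prod>i<dim_vec d. c i (\<kappa> i)) * tensor_bernstein d \<kappa> x)" for x
    by (simp add: c prod_sum_PiE multi_indices_def tensor_bernstein_def prod.distrib)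
  then show ?thesis unfolding bernstein_span_def
    by (intro exI[of _ "\<lambda>\<kappa>. \<Prod>i<dim_vec d. c i (\<kappa> i)"]) blast
qed

lemma bernstein_span_sum:
  assumes "finite A" "\<And>a. a \<in> A \<Longrightarrow> bernstein_span d (q a)"
  shows "bernstein_span d (\<lambda>x. \<Sum>a\<in>A. s a * q a x)"
proof -
  obtain c where c: "\<And>a x. a \<in> A \<Longrightarrow> x \<in> carrier_vec (dim_vec d) \<Longrightarrow>
      q a x = (\<Sum>\<kappa>\<in>multi_indices d. c a \<kappa> * tensor_bernstein d \<kappa> x)"
    using assms(2) unfolding bernstein_span_def by metis
  have "(\<Sum>a\<in>A. s a * q a x) =
      (\<Sum>\<kappa>\<in>multi_indices d. (\<Sum>a\<in>A. s a * c a \<kappa>) * tensor_bernstein d \<kappa> x)"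
    if "x \<in> carrier_vec (dim_vec d)" for x
  proof -
    have "(\<Sum>a\<in>A. s a * q a x) = (\<Sum>a\<in>A. \<Sum>\<kappa>\<in>multi_indices d. s a * c a \<kappa> * tensor_bernstein d \<kappa> x)"
      using that by (simp add: c sum_distrib_left mult_ac)
    also have "\<dots> = (\<Sum>\<kappa>\<in>multi_indices d. \<Sum>a\<in>A. s a * c a \<kappa> * tensor_bernstein d \<kappa> x)"
      by (rule sum.swap)
    finally show ?thesis by (simp add: sum_distrib_right)
  qed
  then show ?thesis unfolding bernstein_span_def
    by (intro exI[of _ "\<lambda>\<kappa>. \<Sum>a\<in>A. s a * c a \<kappa>"]) blast
qed

lemma bernstein_span_peval_box_map:
  assumes "q \<in> int_polys_le d" "dim_vec \<alpha> = dim_vec d"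
  shows "bernstein_span d (peval q \<circ> box_map \<alpha> \<beta>)"
proof -
  let ?g = "\<lambda>m i t. (\<alpha> $ i + (\<beta> $ i - \<alpha> $ i) * t) ^ Poly_Mapping.lookup m i"
  have "bernstein_span d (\<lambda>x. \<Prod>i<dim_vec d. ?g m i (x $ i))" if "m \<in> Poly_Mapping.keys q" for m
  proof (rule bernstein_span_prod)
    fix i assume "i < dim_vec d"
    then have "Poly_Mapping.lookup m i \<le> d $ i"
      using assms(1) that by (auto simp: int_polys_le_def)
    then have "Poly_Mapping.lookup m i + (d $ i - Poly_Mapping.lookup m i) = d $ i" by simp
    from bernstein1_span_powers[OF this, of "\<alpha> $ i" "\<beta> $ i - \<alpha> $ i" 1 0]
    show "\<exists>c. \<forall>t. ?g m i t = (\<Sum>k\<le>d $ i. c k * bernstein1 (d $ i) k t)" by simp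
  qed
  then have "bernstein_span d (\<lambda>x. \<Sum>m\<in>Poly_Mapping.keys q. of_int (Poly_Mapping.lookup q m) *
      (\<Prod>i<dim_vec d. ?g m i (x $ i)))"
    by (intro bernstein_span_sum) auto
  moreover have "(\<Prod>i<dim_vec d. ?g m i (x $ i)) =
      (\<Prod>i\<in>Poly_Mapping.keys m. (box_map \<alpha> \<beta> x $ i) ^ Poly_Mapping.lookup m i)"
    if "m \<in> Poly_Mapping.keys q" for m x
  proof -
    have sub: "Poly_Mapping.keys m \<subseteq> {..<dim_vec d}"
      using assms(1) that by (auto simp: int_polys_le_def)
    have "(\<Prod>i\<in>Poly_Mapping.keys m. (box_map \<alpha> \<beta> x $ i) ^ Poly_Mapping.lookup m i)
        = (\<Prod>i\<in>Poly_Mapping.keys m. ?g m i (x $ i))"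
      using sub assms(2) by (intro prod.cong) (auto simp: box_map_def)
    also have "\<dots> = (\<Prod>i<dim_vec d. ?g m i (x $ i))"
      using sub by (intro prod.mono_neutral_left) (auto simp: in_keys_iff)
    finally show ?thesis by simp
  qed
  ultimately show ?thesis by (simp add: peval_def comp_def)
qed

lemma bernstein_span_bernstein_box_map:
  assumes "\<And>i. i < dim_vec d \<Longrightarrow> \<kappa> $ i \<le> d $ i" "dim_vec \<alpha> = dim_vec d"
  shows "bernstein_span d (bernstein d \<kappa> \<circ> box_map \<alpha> \<beta>)"
proof -
  let ?s = "\<lambda>i t. \<alpha> $ i + (\<beta> $ i - \<alpha> $ i) * t"
  let ?g = "\<lambda>i t. ?s i t ^ (\<kappa> $ i) * (1 - ?s i t) ^ (d $ i - \<kappa> $ i)"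
  have "bernstein_span d (\<lambda>x. \<Prod>i<dim_vec d. ?g i (x $ i))"
  proof (rule bernstein_span_prod)
    fix i assume "i < dim_vec d"
    then have "\<kappa> $ i + (d $ i - \<kappa> $ i) = d $ i" using assms(1) by simp
    have eq: "1 - ?s i t = (1 - \<alpha> $ i) + (- (\<beta> $ i - \<alpha> $ i)) * t" for t by (simp add: algebra_simps)
    from bernstein1_span_powers[OF \<open>_ = d $ i\<close>, of "\<alpha> $ i" "\<beta> $ i - \<alpha> $ i" "1 - \<alpha> $ i" "- (\<beta> $ i - \<alpha> $ i)"]
    show "\<exists>c. \<forall>t. ?g i t = (\<Sum>k\<le>d $ i. c k * bernstein1 (d $ i) k t)" by (simp only: eq)
  qed
  from bernstein_span_sum[of "{()}" d "\<lambda>_. \<lambda>x. \<Prod>i<dim_vec d. ?g i (x $ i)"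
      "\<lambda>_. \<Prod>i<dim_vec d. real ((d $ i) choose (\<kappa> $ i))"] this
  show ?thesis using assms(2)
    by (simp add: bernstein_def box_map_def comp_def prod.distrib mult_ac)
qed

text \<open>Multi-indices occur both as vectors and as extensional functions; the latter are the form in
  which a product of sums expands.\<close>

lemma bij_betw_restrict_vec_index:
  "bij_betw (\<lambda>v. restrict (($) v) {..<n}) {v \<in> carrier_vec n. \<forall>i<n. v $ i \<in> X i} (Pi\<^sub>E {..<n} X)"
proof (rule bij_betw_byWitness[where f'="vec n"])
  show "\<forall>v\<in>{v \<in> carrier_vec n. \<forall>i<n. v $ i \<in> X i}. vec n (restrict (($) v) {..<n}) = v"
    by (auto intro!: eq_vecI)
  show "\<forall>g\<in>Pi\<^sub>E {..<n} X. restrict (($) (vec n g)) {..<n} = g"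
  proof
    fix g assume "g \<in> Pi\<^sub>E {..<n} X"
    then have "restrict g {..<n} = g" by (rule PiE_restrict)
    moreover have "restrict (($) (vec n g)) {..<n} = restrict g {..<n}"
      by (rule restrict_ext) simp
    ultimately show "restrict (($) (vec n g)) {..<n} = g" by simp
  qed
  show "(\<lambda>v. restrict (($) v) {..<n}) ` {v \<in> carrier_vec n. \<forall>i<n. v $ i \<in> X i} \<subseteq> Pi\<^sub>E {..<n} X"
    by (rule image_subsetI) (simp add: restrict_PiE_iff)
  show "vec n ` Pi\<^sub>E {..<n} X \<subseteq> {v \<in> carrier_vec n. \<forall>i<n. v $ i \<in> X i}"
    by (rule image_subsetI) (simp add: PiE_iff)
qed

lemma set_lex_indices:
  "set (lex_indices d) = {v \<in> carrier_vec (dim_vec d). \<forall>i<dim_vec d. v $ i \<le> d $ i}"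
proof -
  have *: "xs \<in> set (product_lists (map (\<lambda>e. [0..<Suc e]) (list_of_vec d))) \<longleftrightarrow>
      length xs = dim_vec d \<and> (\<forall>i<dim_vec d. xs ! i \<le> d $ i)" for xs
    unfolding product_lists_set mem_Collect_eq list_all2_conv_all_nth length_map length_list_of_vec
    by (rule conj_cong[OF refl]) (simp add: list_of_vec_index less_Suc_eq_le del: upt_Suc)
  show ?thesis
  proof (rule subset_antisym; rule subsetI)
    fix v assume "v \<in> set (lex_indices d)"
    then obtain xs where "v = vec_of_list xs" "length xs = dim_vec d" "\<forall>i<dim_vec d. xs ! i \<le> d $ i"
      unfolding lex_indices_def set_map using * by blast
    then show "v \<in> {v \<in> carrier_vec (dim_vec d). \<forall>i<dim_vec d. v $ i \<le> d $ i}"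
      by (auto simp: vec_of_list_index intro!: carrier_vecI)
  next
    fix v assume "v \<in> {v \<in> carrier_vec (dim_vec d). \<forall>i<dim_vec d. v $ i \<le> d $ i}"
    then have "list_of_vec v \<in> set (product_lists (map (\<lambda>e. [0..<Suc e]) (list_of_vec d)))"
      unfolding * by (simp add: list_of_vec_index)
    then show "v \<in> set (lex_indices d)"
      unfolding lex_indices_def set_map by (metis image_eqI vec_list)
  qed
qed

lemma distinct_lex_indices: "distinct (lex_indices d)"
  unfolding lex_indices_def distinct_map
  by (intro conjI distinct_product_lists inj_on_inverseI[where g=list_of_vec])
    (auto simp: list_vec simp del: upt_Suc)

lemma bij_betw_lex_indices:
  "bij_betw (\<lambda>a. restrict (($) (lex_indices d ! a)) {..<dim_vec d}) {..<length (lex_indices d)} (multi_indices d)"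
proof -
  have "bij_betw (\<lambda>v. restrict (($) v) {..<dim_vec d}) (set (lex_indices d)) (multi_indices d)"
    using bij_betw_restrict_vec_index[of "dim_vec d" "\<lambda>i. {..d $ i}"]
    by (simp only: set_lex_indices multi_indices_def atMost_iff)
  moreover have "bij_betw ((!) (lex_indices d)) {..<length (lex_indices d)} (set (lex_indices d))"
    by (intro bij_betw_nth distinct_lex_indices) auto
  ultimately have "bij_betw ((\<lambda>v. restrict (($) v) {..<dim_vec d}) \<circ> (!) (lex_indices d))
      {..<length (lex_indices d)} (multi_indices d)"
    using bij_betw_trans by blast
  then show ?thesis by (simp add: comp_def)
qed

lemma sum_lex_indices:
  "(\<Sum>a<length (lex_indices d). F (restrict (($) (lex_indices d ! a)) {..<dim_vec d})) = sum F (multi_indices d)"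
  using sum.reindex_bij_betw[OF bij_betw_lex_indices] by blast

lemma bernstein_eq_tensor:
  "bernstein d v x = tensor_bernstein d (restrict (($) v) {..<dim_vec d}) x"
  by (simp add: bernstein_def tensor_bernstein_def bernstein1_def)

lemma bernstein_expansion_unique:
  assumes "\<And>x. x \<in> carrier_vec (dim_vec d) \<Longrightarrow>
       (\<Sum>a<length (lex_indices d). u a * bernstein d (lex_indices d ! a) x) =
       (\<Sum>a<length (lex_indices d). v a * bernstein d (lex_indices d ! a) x)"
    and "a < length (lex_indices d)"
  shows "u a = v a"
proof -
  let ?L = "lex_indices d"
  let ?r = "\<lambda>a. restrict (($) (?L ! a)) {..<dim_vec d}"
  define inv_r where "inv_r = inv_into {..<length ?L} ?r"
  have inv: "inv_r (?r b) = b" if "b < length ?L" for b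
    unfolding inv_r_def
    by (rule inv_into_f_f[OF bij_betw_imp_inj_on[OF bij_betw_lex_indices]]) (simp add: that)
  have "(\<Sum>\<kappa>\<in>multi_indices d. (u (inv_r \<kappa>) - v (inv_r \<kappa>)) * tensor_bernstein d \<kappa> x) = 0"
    if "x \<in> carrier_vec (dim_vec d)" for x
    unfolding sum_lex_indices[symmetric]
    using assms(1)[OF that] by (simp add: inv bernstein_eq_tensor left_diff_distrib sum_subtractf)
  moreover have "?r a \<in> multi_indices d"
    using bij_betw_lex_indices[of d] assms(2) by (auto simp: bij_betw_def)
  ultimately have "u (inv_r (?r a)) - v (inv_r (?r a)) = 0"
    using tensor_bernstein_independent[of d "\<lambda>\<kappa>. u (inv_r \<kappa>) - v (inv_r \<kappa>)"] by blast
  then show ?thesis using inv assms(2) by simp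
qed

section \<open>Coordinates and substitution matrices\<close>

lemma bernstein_coords_eqI:
  assumes "v \<in> carrier_vec (length (lex_indices d))"
    and "\<And>x. x \<in> carrier_vec (dim_vec d) \<Longrightarrow>
       q x = (\<Sum>a<length (lex_indices d). v $ a * bernstein d (lex_indices d ! a) x)"
  shows "bernstein_coords d q = v"
  unfolding bernstein_coords_def
proof (rule the_equality)
  fix u assume u: "u \<in> carrier_vec (length (lex_indices d)) \<and>
     (\<forall>x \<in> carrier_vec (dim_vec d). q x = (\<Sum>a<length (lex_indices d). u $ a * bernstein d (lex_indices d ! a) x))"
  have "u $ a = v $ a" if "a < length (lex_indices d)" for a
  proof (rule bernstein_expansion_unique[OF _ that])
    fix x :: "real vec" assume x: "x \<in> carrier_vec (dim_vec d)"
    show "(\<Sum>a<length (lex_indices d). u $ a * bernstein d (lex_indices d ! a) x) =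
        (\<Sum>a<length (lex_indices d). v $ a * bernstein d (lex_indices d ! a) x)"
      using u assms(2)[OF x] x by metis
  qed
  then show "u = v" using u assms(1) by (intro eq_vecI) auto
next
  show "v \<in> carrier_vec (length (lex_indices d)) \<and>
     (\<forall>x \<in> carrier_vec (dim_vec d). q x = (\<Sum>a<length (lex_indices d). v $ a * bernstein d (lex_indices d ! a) x))"
    using assms by blast
qed

lemma bernstein_coords_expansion:
  assumes "bernstein_span d q" "x \<in> carrier_vec (dim_vec d)"
  shows "q x = (\<Sum>a<length (lex_indices d). bernstein_coords d q $ a * bernstein d (lex_indices d ! a) x)"
proof -
  obtain c where c: "\<And>x. x \<in> carrier_vec (dim_vec d) \<Longrightarrow>
      q x = (\<Sum>\<kappa>\<in>multi_indices d. c \<kappa> * tensor_bernstein d \<kappa> x)"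
    using assms(1) unfolding bernstein_span_def by blast
  define v where "v = vec (length (lex_indices d)) (\<lambda>a. c (restrict (($) (lex_indices d ! a)) {..<dim_vec d}))"
  have v: "q x = (\<Sum>a<length (lex_indices d). v $ a * bernstein d (lex_indices d ! a) x)"
    if "x \<in> carrier_vec (dim_vec d)" for x
    using that by (simp add: c v_def bernstein_eq_tensor flip: sum_lex_indices)
  have "bernstein_coords d q = v"
    by (intro bernstein_coords_eqI v) (auto simp: v_def)
  then show ?thesis using v assms(2) by simp
qed

text \<open>If the box from \<open>\<alpha>'\<close> to \<open>\<beta>'\<close> is the image of the box from \<open>a\<close> to \<open>b\<close> under the
  parametrisation of the box from \<open>\<alpha>\<close> to \<open>\<beta>\<close>, then the parametrisations compose. Substituting in a
  Bernstein expansion term by term and collecting coefficients is the matrix product.\<close>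

lemma subst_matrix_mult_d_matrix:
  assumes h: "\<And>i. i < r \<Longrightarrow> h i \<in> int_polys_le d"
    and dims: "dim_vec \<alpha> = dim_vec d" "dim_vec a = dim_vec d"
    and dims': "dim_vec \<alpha>' = dim_vec d"
    and lo: "\<And>i. i < dim_vec d \<Longrightarrow> \<alpha>' $ i = \<alpha> $ i + (\<beta> $ i - \<alpha> $ i) * a $ i"
    and hi: "\<And>i. i < dim_vec d \<Longrightarrow> \<beta>' $ i = \<alpha> $ i + (\<beta> $ i - \<alpha> $ i) * b $ i"
  shows "subst_matrix d a b * d_matrix d r h \<alpha> \<beta> = d_matrix d r h \<alpha>' \<beta>'"
proof (rule eq_matI)
  have comp: "box_map \<alpha>' \<beta>' x = box_map \<alpha> \<beta> (box_map a b x)" for x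
    by (rule eq_vecI) (simp_all add: box_map_def dims dims' lo hi algebra_simps)
  let ?L = "lex_indices d"
  fix e i assume "e < dim_row (d_matrix d r h \<alpha>' \<beta>')" "i < dim_col (d_matrix d r h \<alpha>' \<beta>')"
  then have e: "e < length ?L" and i: "i < r" by (auto simp: d_matrix_def)
  let ?q = "peval (h i) \<circ> box_map \<alpha> \<beta>"
  let ?u = "bernstein_coords d ?q"
  let ?B = "\<lambda>c. bernstein_coords d (bernstein d (?L ! c) \<circ> box_map a b)"
  define v where "v = vec (length ?L) (\<lambda>e. \<Sum>c<length ?L. ?B c $ e * ?u $ c)"
  have "bernstein_coords d (peval (h i) \<circ> box_map \<alpha>' \<beta>') = v"
  proof (rule bernstein_coords_eqI)
    fix x :: "real vec" assume x: "x \<in> carrier_vec (dim_vec d)"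
    have bx: "box_map a b x \<in> carrier_vec (dim_vec d)" using dims by (simp add: box_map_def)
    have B: "(bernstein d (?L ! c) \<circ> box_map a b) x = (\<Sum>e<length ?L. ?B c $ e * bernstein d (?L ! e) x)"
      if "c < length ?L" for c
      using that set_lex_indices[of d] nth_mem[OF that] x dims
      by (intro bernstein_coords_expansion bernstein_span_bernstein_box_map) auto
    have "(peval (h i) \<circ> box_map \<alpha>' \<beta>') x = ?q (box_map a b x)" by (simp add: comp)
    also have "\<dots> = (\<Sum>c<length ?L. ?u $ c * bernstein d (?L ! c) (box_map a b x))"
      using h[OF i] dims bx by (intro bernstein_coords_expansion bernstein_span_peval_box_map)
    also have "\<dots> = (\<Sum>c<length ?L. \<Sum>e<length ?L. ?B c $ e * ?u $ c * bernstein d (?L ! e) x)"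
      using B by (simp add: sum_distrib_left mult_ac)
    also have "\<dots> = (\<Sum>e<length ?L. \<Sum>c<length ?L. ?B c $ e * ?u $ c * bernstein d (?L ! e) x)"
      by (rule sum.swap)
    also have "\<dots> = (\<Sum>e<length ?L. v $ e * bernstein d (?L ! e) x)"
      by (simp add: v_def sum_distrib_right)
    finally show "(peval (h i) \<circ> box_map \<alpha>' \<beta>') x = (\<Sum>e<length ?L. v $ e * bernstein d (?L ! e) x)" .
  qed (simp add: v_def)
  then show "(subst_matrix d a b * d_matrix d r h \<alpha> \<beta>) $$ (e, i) = d_matrix d r h \<alpha>' \<beta>' $$ (e, i)"
    using e i by (simp add: d_matrix_def subst_matrix_def v_def scalar_prod_def atLeast0LessThan)
qed (auto simp: d_matrix_def subst_matrix_def)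

section \<open>Expected sizes of the generations\<close>

text \<open>The number of individuals as a function of the offspring counts. Writing \<open>Z i\<close> in this form
  displays that it depends only on the offspring of the generations before \<open>i\<close>.\<close>

fun branching_size :: "(nat \<times> nat \<Rightarrow> nat) \<Rightarrow> nat \<Rightarrow> nat" where
  "branching_size g 0 = 1"
| "branching_size g (Suc i) = (\<Sum>j<branching_size g i. g (i, j))"

lemma branching_size_cong:
  "(\<And>i' j. i' < i \<Longrightarrow> g (i', j) = g' (i', j)) \<Longrightarrow> branching_size g i = branching_size g' i"
  by (induction i) auto

lemma measurable_branching_size:
  "\<lbrakk>\<And>i' j. i' < i \<Longrightarrow> (\<lambda>\<omega>. G \<omega> (i', j)) \<in> M \<rightarrow>\<^sub>M count_space UNIV\<rbrakk> \<Longrightarrow>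
   (\<lambda>\<omega>. branching_size (G \<omega>) i) \<in> M \<rightarrow>\<^sub>M count_space UNIV"
proof (induction i)
  case 0
  then show ?case by simp
next
  case (Suc i)
  have "(\<lambda>\<omega>. branching_size (G \<omega>) i) \<in> M \<rightarrow>\<^sub>M count_space UNIV"
    using Suc by simp
  then show ?case unfolding branching_size.simps
    by (rule measurable_compose_countable[rotated]) (intro measurable_sum_nat Suc.prems lessI)
qed

text \<open>Wald's identity for a bounded number \<open>Y\<close> of summands with values 0 and 2. Almost surely the
  random sum is \<open>\<Sum>j<b. 2 * 1[j < Y and X j = 2]\<close>; independence factors each expectation into
  \<open>2 * P(j < Y) * \<rho>\<close>, and \<open>\<Sum>j<b. P(j < Y)\<close> is the expectation of \<open>Y\<close>. The second part propagates
  the bound to the next generation.\<close>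

lemma (in prob_space) expectation_branching_step:
  fixes Y :: "'a \<Rightarrow> nat" and X :: "nat \<Rightarrow> 'a \<Rightarrow> nat" and \<rho> :: real
  assumes indep: "\<And>j. indep_var (count_space UNIV) Y (count_space UNIV) (X j)"
    and bound: "AE \<omega> in M. Y \<omega> \<le> b"
    and X0: "\<And>j. prob {\<omega> \<in> space M. X j \<omega> = 0} = 1 - \<rho>"
    and X2: "\<And>j. prob {\<omega> \<in> space M. X j \<omega> = 2} = \<rho>"
  shows "expectation (\<lambda>\<omega>. real (\<Sum>j<Y \<omega>. X j \<omega>)) = 2 * \<rho> * expectation (\<lambda>\<omega>. real (Y \<omega>))"
    and "AE \<omega> in M. (\<Sum>j<Y \<omega>. X j \<omega>) \<le> 2 * b"
proof -
  have Y [measurable]: "Y \<in> M \<rightarrow>\<^sub>M count_space UNIV"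
    and X [measurable]: "\<And>j. X j \<in> M \<rightarrow>\<^sub>M count_space UNIV"
    using indep indep_var_rv1 indep_var_rv2 by blast+
  have "AE \<omega> in M. X j \<omega> = 0 \<or> X j \<omega> = 2" for j
  proof -
    have "prob ({\<omega> \<in> space M. X j \<omega> = 0} \<union> {\<omega> \<in> space M. X j \<omega> = 2}) = 1"
      using X0[of j] X2[of j] by (subst finite_measure_Union) auto
    moreover have "{\<omega> \<in> space M. X j \<omega> = 0} \<union> {\<omega> \<in> space M. X j \<omega> = 2} = {\<omega> \<in> space M. X j \<omega> = 0 \<or> X j \<omega> = 2}"
      by auto
    ultimately show ?thesis by (subst prob_Collect_eq_1[symmetric]) auto
  qed
  then have X02: "AE \<omega> in M. \<forall>j. X j \<omega> = 0 \<or> X j \<omega> = 2"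
    by (simp add: AE_all_countable)
  show "AE \<omega> in M. (\<Sum>j<Y \<omega>. X j \<omega>) \<le> 2 * b"
    using X02 bound
  proof eventually_elim
    case (elim \<omega>)
    have "(\<Sum>j<Y \<omega>. X j \<omega>) \<le> (\<Sum>j<Y \<omega>. 2)"
    proof (rule sum_mono)
      show "X j \<omega> \<le> 2" for j using elim(1) by (metis order.refl zero_le)
    qed
    then show ?case using elim(2) by simp
  qed
  let ?A = "\<lambda>j. {\<omega> \<in> space M. j < Y \<omega>}" and ?C = "\<lambda>j. {\<omega> \<in> space M. j < Y \<omega> \<and> X j \<omega> = 2}"
  have meas [measurable]: "(\<lambda>\<omega>. \<Sum>j<Y \<omega>. X j \<omega>) \<in> M \<rightarrow>\<^sub>M count_space UNIV"
    by (rule measurable_compose_countable[where f="\<lambda>m \<omega>. \<Sum>j<m. X j \<omega>"]) measurable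
  have trunc: "(\<Sum>j<m. f j) = (\<Sum>j<b. if j < m then f j else 0)" if "m \<le> b" for m and f :: "nat \<Rightarrow> real"
  proof -
    have "{j \<in> {..<b}. j < m} = {..<m}" using that by auto
    then show ?thesis by (simp add: sum.inter_filter[symmetric])
  qed
  have "expectation (\<lambda>\<omega>. real (\<Sum>j<Y \<omega>. X j \<omega>)) = expectation (\<lambda>\<omega>. \<Sum>j<b. 2 * indicator (?C j) \<omega>)"
  proof (rule integral_cong_AE)
    show "AE \<omega> in M. real (\<Sum>j<Y \<omega>. X j \<omega>) = (\<Sum>j<b. 2 * indicator (?C j) \<omega>)"
      using X02 bound AE_space
    proof eventually_elim
      case (elim \<omega>)
      have "real (X j \<omega>) = 2 * indicator {\<omega> \<in> space M. X j \<omega> = 2} \<omega>" for j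
        using elim(1,3) by (auto simp: indicator_def)
      then have "real (\<Sum>j<Y \<omega>. X j \<omega>) = (\<Sum>j<b. if j < Y \<omega> then 2 * indicator {\<omega> \<in> space M. X j \<omega> = 2} \<omega> else 0)"
        unfolding of_nat_sum trunc[OF elim(2), of "\<lambda>j. real (X j \<omega>)"] by (simp only:)
      also have "\<dots> = (\<Sum>j<b. 2 * indicator (?C j) \<omega>)"
        by (intro sum.cong) (auto simp: indicator_def)
      finally show ?case .
    qed
  qed measurable
  also have "\<dots> = (\<Sum>j<b. 2 * prob (?C j))"
    by (subst Bochner_Integration.integral_sum) (auto simp: emeasure_eq_measure intro!: integrable_mult_right integrable_real_indicator)
  also have "\<dots> = (\<Sum>j<b. 2 * \<rho> * prob (?A j))"
  proof (rule sum.cong[OF refl])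
    fix j
    have "prob ((\<lambda>x. (Y x, X j x)) -` ({j<..} \<times> {2}) \<inter> space M) =
        prob (Y -` {j<..} \<inter> space M) * prob (X j -` {2} \<inter> space M)"
      by (intro indep_varD[OF indep]) auto
    moreover have "(\<lambda>x. (Y x, X j x)) -` ({j<..} \<times> {2}) \<inter> space M = ?C j"
        "Y -` {j<..} \<inter> space M = ?A j" "X j -` {2} \<inter> space M = {\<omega> \<in> space M. X j \<omega> = 2}" by auto
    ultimately show "2 * prob (?C j) = 2 * \<rho> * prob (?A j)" using X2[of j] by simp
  qed
  also have "\<dots> = 2 * \<rho> * expectation (\<lambda>\<omega>. \<Sum>j<b. indicator (?A j) \<omega>)"
    by (subst Bochner_Integration.integral_sum) (auto simp: sum_distrib_left emeasure_eq_measure intro!: integrable_real_indicator)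
  also have "expectation (\<lambda>\<omega>. \<Sum>j<b. indicator (?A j) \<omega>) = expectation (\<lambda>\<omega>. real (Y \<omega>))"
  proof (rule integral_cong_AE)
    show "AE \<omega> in M. (\<Sum>j<b. indicator (?A j) \<omega>) = real (Y \<omega>)"
      using bound AE_space
    proof eventually_elim
      case (elim \<omega>)
      have "(\<Sum>j<b. indicator (?A j) \<omega>) = (\<Sum>j<b. if j < Y \<omega> then 1 else 0 :: real)"
        using elim(2) by (intro sum.cong) (auto simp: indicator_def)
      then show ?case using trunc[OF elim(1), of "\<lambda>_. 1"] by simp
    qed
  qed measurable
  finally show "expectation (\<lambda>\<omega>. real (\<Sum>j<Y \<omega>. X j \<omega>)) = 2 * \<rho> * expectation (\<lambda>\<omega>. real (Y \<omega>))" .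
qed

lemma expectation_branching_model:
  assumes "branching_model M N lam Z" "i \<le> N"
  shows "prob_space.expectation M (\<lambda>\<omega>. real (Z i \<omega>)) = 2 ^ i * (\<Prod>j<i. 1 - (1 - lam) ^ 2 ^ (N - j))"
proof -
  interpret prob_space M using assms by (simp add: branching_model_def)
  obtain X :: "nat \<Rightarrow> nat \<Rightarrow> 'a \<Rightarrow> nat" where
    indep: "indep_vars (\<lambda>_. count_space UNIV) (\<lambda>(i, j). X i j) ({..<N} \<times> UNIV)" and
    X: "\<And>i j. i < N \<Longrightarrow> prob {\<omega> \<in> space M. X i j \<omega> = 0} = (1 - lam) ^ 2 ^ (N - i)"
      "\<And>i j. i < N \<Longrightarrow> prob {\<omega> \<in> space M. X i j \<omega> = 2} = 1 - (1 - lam) ^ 2 ^ (N - i)" and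
    Z0: "\<And>\<omega>. \<omega> \<in> space M \<Longrightarrow> Z 0 \<omega> = 1" and
    ZS: "\<And>i \<omega>. i < N \<Longrightarrow> \<omega> \<in> space M \<Longrightarrow> Z (Suc i) \<omega> = (\<Sum>j<Z i \<omega>. X i j \<omega>)"
    using assms(1) unfolding branching_model_def by blast
  define Y where "Y i \<omega> = branching_size (\<lambda>(i, j). X i j \<omega>) i" for i \<omega>
  have ZY: "Z i \<omega> = Y i \<omega>" if "i \<le> N" "\<omega> \<in> space M" for i \<omega>
    using that by (induction i) (auto simp: Z0 ZS Y_def)
  have indep_YX: "indep_var (count_space UNIV) (Y i) (count_space UNIV) (X i j)" if "i < N" for i j
  proof -
    let ?A = "{..<i} \<times> (UNIV :: nat set)" and ?B = "{(i, j)}"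
    let ?X = "\<lambda>\<omega> x. (case x of (i, j) \<Rightarrow> X i j) \<omega>"
    have "indep_var (PiM ?A (\<lambda>_. count_space UNIV)) (\<lambda>\<omega>. restrict (?X \<omega>) ?A)
       (PiM ?B (\<lambda>_. count_space UNIV)) (\<lambda>\<omega>. restrict (?X \<omega>) ?B)"
      using that by (intro indep_var_restrict[OF indep]) auto
    then have "indep_var (count_space UNIV) ((\<lambda>g. branching_size g i) \<circ> (\<lambda>\<omega>. restrict (?X \<omega>) ?A))
       (count_space UNIV) ((\<lambda>g. g (i, j)) \<circ> (\<lambda>\<omega>. restrict (?X \<omega>) ?B))"
      by (rule indep_var_compose) (auto intro!: measurable_branching_size measurable_component_singleton)
    moreover have "(\<lambda>g. branching_size g i) \<circ> (\<lambda>\<omega>. restrict (?X \<omega>) ?A) = Y i"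
      unfolding comp_def Y_def by (intro ext branching_size_cong) auto
    moreover have "(\<lambda>g. g (i, j)) \<circ> (\<lambda>\<omega>. restrict (?X \<omega>) ?B) = X i j"
      by auto
    ultimately show ?thesis by simp
  qed
  have YS: "Y (Suc i) = (\<lambda>\<omega>. \<Sum>j<Y i \<omega>. X i j \<omega>)" for i
    by (auto simp: Y_def)
  have "(AE \<omega> in M. Y i \<omega> \<le> 2 ^ i) \<and>
      expectation (\<lambda>\<omega>. real (Y i \<omega>)) = 2 ^ i * (\<Prod>j<i. 1 - (1 - lam) ^ 2 ^ (N - j))"
    if "i \<le> N" for i
    using that
  proof (induction i)
    case 0
    then show ?case by (simp add: Y_def prob_space)
  next
    case (Suc i)
    then have i: "i < N" and bound: "AE \<omega> in M. Y i \<omega> \<le> 2 ^ i" by auto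
    have X0: "prob {\<omega> \<in> space M. X i j \<omega> = 0} = 1 - (1 - (1 - lam) ^ 2 ^ (N - i))" for j
      using X(1)[OF i] by simp
    show ?case
      using expectation_branching_step[where X="X i" and Y="Y i", OF indep_YX[OF i] bound X0 X(2)[OF i]] Suc
      by (simp add: YS mult_ac)
  qed
  moreover have "expectation (\<lambda>\<omega>. real (Z i \<omega>)) = expectation (\<lambda>\<omega>. real (Y i \<omega>))"
    using ZY assms(2) by (intro Bochner_Integration.integral_cong) auto
  ultimately show ?thesis using assms(2) by simp
qed

lemma expected_mults_branching_model:
  assumes "branching_model M N lam Z"
  shows "expected_mults M N Z = (\<Sum>i\<le>N. 2 ^ i * (\<Prod>j<i. 1 - (1 - lam) ^ 2 ^ (N - j))) - 1"
  unfolding expected_mults_def expected_boxes_def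
  using expectation_branching_model[OF assms] by simp

section \<open>Dyadic boxes\<close>

lemma dbox_nonempty_iff:
  "dbox n k l \<kappa> \<noteq> {} \<longleftrightarrow>
     l \<in> carrier_vec n \<and> \<kappa> \<in> carrier_vec n \<and> (\<forall>i<n. \<kappa> $ i \<le> k \<and> l $ i < 2 ^ (k - \<kappa> $ i))"
proof (cases "l \<in> carrier_vec n \<and> \<kappa> \<in> carrier_vec n \<and> (\<forall>i<n. \<kappa> $ i \<le> k \<and> l $ i < 2 ^ (k - \<kappa> $ i))")
  case True
  then have dims: "dim_vec l = n" by (auto dest: carrier_vecD)
  have "box_lo l \<kappa> \<in> dbox n k l \<kappa>"
    unfolding dbox_def if_P[OF True] using dims
    by (auto simp: box_lo_def box_hi_def intro: carrier_vecI)
  then show ?thesis using True by blast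
next
  case False
  then show ?thesis unfolding dbox_def if_not_P[OF False] by blast
qed

lemma card_unit_boxes: "card {l. dbox n k l (0\<^sub>v n) \<noteq> {}} = 2 ^ (n * k)"
proof -
  have "{l. dbox n k l (0\<^sub>v n) \<noteq> {}} = {l \<in> carrier_vec n. \<forall>i<n. l $ i \<in> {..<2 ^ k :: nat}}"
    unfolding dbox_nonempty_iff by (rule Collect_cong) auto
  then have "bij_betw (\<lambda>l. restrict (($) l) {..<n}) {l. dbox n k l (0\<^sub>v n) \<noteq> {}} (Pi\<^sub>E {..<n} (\<lambda>_. {..<2 ^ k}))"
    using bij_betw_restrict_vec_index[of n "\<lambda>_. {..<2 ^ k :: nat}"] by (simp only:)
  then have "card {l. dbox n k l (0\<^sub>v n) \<noteq> {}} = card (Pi\<^sub>E {..<n} (\<lambda>_. {..<2 ^ k :: nat}))"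
    by (rule bij_betw_same_card)
  also have "\<dots> = 2 ^ (n * k)" by (simp add: card_PiE power_mult mult.commute)
  finally show ?thesis .
qed

lemma prob_unit_box_meets_set:
  "measure_pmf.prob (pmf_of_set {l. dbox n k l (0\<^sub>v n) \<noteq> {}}) {l. dbox n k l (0\<^sub>v n) \<inter> S \<noteq> {}} =
     real (card {l. dbox n k l (0\<^sub>v n) \<inter> S \<noteq> {}}) / 2 ^ (n * k)"
proof -
  let ?U = "{l. dbox n k l (0\<^sub>v n) \<noteq> {}}"
  have "card ?U > 0" by (simp add: card_unit_boxes)
  then have "finite ?U" "?U \<noteq> {}" by (auto simp only: card_gt_0_iff)
  moreover have "?U \<inter> {l. dbox n k l (0\<^sub>v n) \<inter> S \<noteq> {}} = {l. dbox n k l (0\<^sub>v n) \<inter> S \<noteq> {}}"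
    by auto
  ultimately show ?thesis by (simp add: measure_pmf_of_set card_unit_boxes)
qed

text \<open>The scalar \<open>s\<close> selects the half: 0 for the left one and 1 for the right one.\<close>

lemma dbox_halves_nonempty:
  assumes "dbox n k l \<kappa> \<noteq> {}" "j < n" "0 < \<kappa> $ j" "s \<le> 1"
  shows "dbox n k (l + (l $ j) \<cdot>\<^sub>v unit_vec n j + s \<cdot>\<^sub>v unit_vec n j) (\<kappa> - unit_vec n j) \<noteq> {}"
proof -
  have l: "dim_vec l = n" "dim_vec \<kappa> = n"
    and b: "\<And>i. i < n \<Longrightarrow> \<kappa> $ i \<le> k" "\<And>i. i < n \<Longrightarrow> l $ i < 2 ^ (k - \<kappa> $ i)"
    using assms(1) by (auto simp: dbox_nonempty_iff)
  have "k - (\<kappa> $ j - 1) = Suc (k - \<kappa> $ j)" using assms(3) b(1)[OF assms(2)] by simp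
  then have bj: "l $ j + l $ j + s < 2 ^ (k - (\<kappa> $ j - 1))"
    using b(2)[OF assms(2)] assms(4) by simp
  show ?thesis
    unfolding dbox_nonempty_iff
  proof (intro conjI allI impI)
    fix i assume i: "i < n"
    show "(\<kappa> - unit_vec n j) $ i \<le> k"
      using b(1)[OF i] l i by (simp add: unit_vec_def)
    show "(l + (l $ j) \<cdot>\<^sub>v unit_vec n j + s \<cdot>\<^sub>v unit_vec n j) $ i < 2 ^ (k - (\<kappa> - unit_vec n j) $ i)"
      using bj b(2)[OF i] l i assms(2) by (cases "i = j"; simp)
  qed (use l in \<open>auto intro: carrier_vecI\<close>)
qed

lemma left_matrix_mult_d_matrix:
  assumes h: "\<And>i. i < r \<Longrightarrow> h i \<in> int_polys_le d"
    and dims: "dim_vec d = n" "dim_vec l = n" "dim_vec \<kappa> = n" and j: "j < n" "0 < \<kappa> $ j"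
    and l': "l' = l + (l $ j) \<cdot>\<^sub>v unit_vec n j" and \<kappa>': "\<kappa>' = \<kappa> - unit_vec n j"
  shows "left_matrix d j * d_matrix d r h (box_lo l \<kappa>) (box_hi l \<kappa>) = d_matrix d r h (box_lo l' \<kappa>') (box_hi l' \<kappa>')"
  unfolding left_matrix_def
proof (rule subst_matrix_mult_d_matrix[OF h])
  have pow: "(2::real) ^ (\<kappa> $ j) = 2 * 2 ^ (\<kappa> $ j - 1)"
    using j(2) by (cases "\<kappa> $ j") auto
  fix i assume "i < dim_vec d"
  then show "box_lo l' \<kappa>' $ i = box_lo l \<kappa> $ i + (box_hi l \<kappa> $ i - box_lo l \<kappa> $ i) *
      vec (dim_vec d) (\<lambda>i. 0) $ i"
    and "box_hi l' \<kappa>' $ i = box_lo l \<kappa> $ i + (box_hi l \<kappa> $ i - box_lo l \<kappa> $ i) *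
      vec (dim_vec d) (\<lambda>i. if i = j then 1 / 2 else 1) $ i"
    using dims j(1) pow by (cases "i = j"; simp add: l' \<kappa>' box_lo_def box_hi_def algebra_simps)+
qed (simp_all add: box_lo_def l' dims)

lemma right_matrix_mult_d_matrix:
  assumes h: "\<And>i. i < r \<Longrightarrow> h i \<in> int_polys_le d"
    and dims: "dim_vec d = n" "dim_vec l = n" "dim_vec \<kappa> = n" and j: "j < n" "0 < \<kappa> $ j"
    and l': "l' = l + (l $ j) \<cdot>\<^sub>v unit_vec n j + unit_vec n j" and \<kappa>': "\<kappa>' = \<kappa> - unit_vec n j"
  shows "right_matrix d j * d_matrix d r h (box_lo l \<kappa>) (box_hi l \<kappa>) = d_matrix d r h (box_lo l' \<kappa>') (box_hi l' \<kappa>')"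
  unfolding right_matrix_def
proof (rule subst_matrix_mult_d_matrix[OF h])
  have pow: "(2::real) ^ (\<kappa> $ j) = 2 * 2 ^ (\<kappa> $ j - 1)"
    using j(2) by (cases "\<kappa> $ j") auto
  fix i assume "i < dim_vec d"
  then show "box_lo l' \<kappa>' $ i = box_lo l \<kappa> $ i + (box_hi l \<kappa> $ i - box_lo l \<kappa> $ i) *
      vec (dim_vec d) (\<lambda>i. if i = j then 1 / 2 else 0) $ i"
    and "box_hi l' \<kappa>' $ i = box_lo l \<kappa> $ i + (box_hi l \<kappa> $ i - box_lo l \<kappa> $ i) *
      vec (dim_vec d) (\<lambda>i. 1) $ i"
    using dims j(1) pow by (cases "i = j"; simp add: l' \<kappa>' box_lo_def box_hi_def algebra_simps)+
qed (simp_all add: box_lo_def l' dims)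

section \<open>Runs of the algorithm\<close>

text \<open>The invariant is that a call on a box receives the matrix of \<open>h\<close> over that box. Describing \<open>R\<close>
  by a condition on boxes, rather than by the calls that produced it, makes the claim stable under
  the union of the results of the two recursive calls.\<close>

lemma SolveCE_rejects_iff:
  assumes "SolveCE d p w \<kappa> l B R m S"
    and h: "\<And>i. i < r \<Longrightarrow> h i \<in> int_polys_le d" and d: "d \<in> carrier_vec n"
    and "dbox n k l \<kappa> \<noteq> {}" and "w = d_matrix d r h (box_lo l \<kappa>) (box_hi l \<kappa>)"
  shows "\<forall>(l, \<kappa>)\<in>set B. dbox n k l \<kappa> \<noteq> {}"
    and "R = {(l, \<kappa>) \<in> set B. \<not> all_hasSol p (d_matrix d r h (box_lo l \<kappa>) (box_hi l \<kappa>))}"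
proof -
  have "(\<forall>(l, \<kappa>)\<in>set B. dbox n k l \<kappa> \<noteq> {}) \<and>
      R = {(l, \<kappa>) \<in> set B. \<not> all_hasSol p (d_matrix d r h (box_lo l \<kappa>) (box_hi l \<kappa>))}"
    using assms(1,4,5)
  proof (induction rule: SolveCE.induct)
    case (reject w \<kappa> l)
    then show ?case by auto
  next
    case (unit_box w \<kappa> l)
    then show ?case by auto
  next
    case (subdivide w j \<kappa> e l B R m S B' R' m' S')
    have "l \<in> carrier_vec n" "\<kappa> \<in> carrier_vec n"
      using subdivide.prems(1) unfolding dbox_nonempty_iff by blast+
    then have dims: "dim_vec d = n" "dim_vec l = n" "dim_vec \<kappa> = n"
      using d by (simp_all only: carrier_vecD)
    have j: "j < n" and e: "e = unit_vec n j"
      using subdivide.hyps(2,5) dims(3) by simp_all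
    have zero: "l + (l $ j) \<cdot>\<^sub>v unit_vec n j + 0 \<cdot>\<^sub>v unit_vec n j = l + (l $ j) \<cdot>\<^sub>v unit_vec n j"
      and one: "1 \<cdot>\<^sub>v unit_vec n j = (unit_vec n j :: nat vec)"
      using dims by (auto intro: eq_vecI)
    have "dbox n k (l + (l $ j) \<cdot>\<^sub>v e) (\<kappa> - e) \<noteq> {}"
      using dbox_halves_nonempty[OF subdivide.prems(1) j subdivide.hyps(4), of 0] unfolding zero e by simp
    moreover have "left_matrix d j * w =
        d_matrix d r h (box_lo (l + (l $ j) \<cdot>\<^sub>v e) (\<kappa> - e)) (box_hi (l + (l $ j) \<cdot>\<^sub>v e) (\<kappa> - e))"
      unfolding subdivide.prems(2) e
      by (rule left_matrix_mult_d_matrix[OF h dims j subdivide.hyps(4) refl refl])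
    ultimately have IH1: "(\<forall>(l, \<kappa>)\<in>set B. dbox n k l \<kappa> \<noteq> {}) \<and>
        R = {(l, \<kappa>) \<in> set B. \<not> all_hasSol p (d_matrix d r h (box_lo l \<kappa>) (box_hi l \<kappa>))}"
      by (rule subdivide.IH(1))
    have "dbox n k (l + (l $ j) \<cdot>\<^sub>v e + e) (\<kappa> - e) \<noteq> {}"
      using dbox_halves_nonempty[OF subdivide.prems(1) j subdivide.hyps(4), of 1] unfolding one e by simp
    moreover have "right_matrix d j * w =
        d_matrix d r h (box_lo (l + (l $ j) \<cdot>\<^sub>v e + e) (\<kappa> - e)) (box_hi (l + (l $ j) \<cdot>\<^sub>v e + e) (\<kappa> - e))"
      unfolding subdivide.prems(2) e
      by (rule right_matrix_mult_d_matrix[OF h dims j subdivide.hyps(4) refl refl])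
    ultimately have IH2: "(\<forall>(l, \<kappa>)\<in>set B'. dbox n k l \<kappa> \<noteq> {}) \<and>
        R' = {(l, \<kappa>) \<in> set B'. \<not> all_hasSol p (d_matrix d r h (box_lo l \<kappa>) (box_hi l \<kappa>))}"
      by (rule subdivide.IH(2))
    have "all_hasSol p (d_matrix d r h (box_lo l \<kappa>) (box_hi l \<kappa>))"
      using subdivide.hyps(1) subdivide.prems(2) by simp
    then show ?case
      using IH1 IH2 subdivide.prems(1) by auto
  qed
  then show "\<forall>(l, \<kappa>)\<in>set B. dbox n k l \<kappa> \<noteq> {}"
    and "R = {(l, \<kappa>) \<in> set B. \<not> all_hasSol p (d_matrix d r h (box_lo l \<kappa>) (box_hi l \<kappa>))}"
    by blast+
qed

lemma SolveCE_mults_eq_boxes: "SolveCE d p w \<kappa> l B R m S \<Longrightarrow> m + 1 = length B"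
  by (induction rule: SolveCE.induct) auto

theorem theorem4p4:
  fixes n r k :: nat
    and d d' :: "nat vec"
    and h :: "nat \<Rightarrow> int_mpoly"
    and p :: "nat \<Rightarrow> int"
    and lam :: real
    and M :: "'a measure"
    and Z :: "nat \<Rightarrow> 'a \<Rightarrow> nat"
  assumes d: "d \<in> carrier_vec n"
    and h: "\<forall>i<r. h i \<in> int_polys_le d"
    and p: "\<forall>i<r. p i \<ge> 2"
    and k: "k = nat \<lceil>log 2 (real_of_int (Lcm (p ` {..<r})))\<rceil>"
    and d': "d' \<in> carrier_vec n"
    and h_d': "\<forall>i<r. h i \<in> int_polys_le d'"
    and equiv: "\<forall>d'' \<ge> d'. \<forall>l \<kappa>. dbox n k l \<kappa> \<noteq> {} \<longrightarrow>
       (all_hasSol p (d_matrix d'' r h (box_lo l \<kappa>) (box_hi l \<kappa>))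
          \<longleftrightarrow> dbox n k l \<kappa> \<inter> sol_set n r h p \<noteq> {}) \<and>
       (dbox n k l \<kappa> \<inter> sol_set n r h p \<noteq> {}
          \<longleftrightarrow> (\<exists>l'. dbox n k l' (0\<^sub>v n) \<subseteq> dbox n k l \<kappa> \<and>
                   dbox n k l' (0\<^sub>v n) \<inter> sol_set n r h p \<noteq> {}))"
    and lam: "lam = unit_density n k r h p"
    and model: "branching_model M (n * k) lam Z"
  shows "expected_mults M (n * k) Z =
           (\<Sum>i\<le>n * k. 2 ^ i * (\<Prod>j<i. 1 - (1 - lam) ^ 2 ^ (n * k - j))) - 1 \<and>
         measure_pmf.prob (pmf_of_set {l. dbox n k l (0\<^sub>v n) \<noteq> {}})
           {l. dbox n k l (0\<^sub>v n) \<inter> sol_set n r h p \<noteq> {}} = lam \<and>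
         (\<forall>B R m S.
           SolveCE d' p
             (d_matrix d' r h (box_lo (0\<^sub>v n) (vec n (\<lambda>_. k))) (box_hi (0\<^sub>v n) (vec n (\<lambda>_. k))))
             (vec n (\<lambda>_. k)) (0\<^sub>v n) B R m S \<longrightarrow>
           m + 1 = length B \<and>
           (\<forall>(l, \<kappa>) \<in> set B. (l, \<kappa>) \<in> R \<longleftrightarrow>
              \<not> (\<exists>l'. dbox n k l' (0\<^sub>v n) \<subseteq> dbox n k l \<kappa> \<and>
                     dbox n k l' (0\<^sub>v n) \<inter> sol_set n r h p \<noteq> {})))"
proof (intro conjI allI impI)
  show "expected_mults M (n * k) Z =
      (\<Sum>i\<le>n * k. 2 ^ i * (\<Prod>j<i. 1 - (1 - lam) ^ 2 ^ (n * k - j))) - 1"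
    using model by (rule expected_mults_branching_model)
next
  show "measure_pmf.prob (pmf_of_set {l. dbox n k l (0\<^sub>v n) \<noteq> {}})
      {l. dbox n k l (0\<^sub>v n) \<inter> sol_set n r h p \<noteq> {}} = lam"
    unfolding lam unit_density_def by (rule prob_unit_box_meets_set)
next
  fix B R m S
  assume run: "SolveCE d' p
      (d_matrix d' r h (box_lo (0\<^sub>v n) (vec n (\<lambda>_. k))) (box_hi (0\<^sub>v n) (vec n (\<lambda>_. k))))
      (vec n (\<lambda>_. k)) (0\<^sub>v n) B R m S"
  show "m + 1 = length B"
    using run by (rule SolveCE_mults_eq_boxes)
  have start: "dbox n k (0\<^sub>v n) (vec n (\<lambda>_. k)) \<noteq> {}"
    unfolding dbox_nonempty_iff by simp
  have h_le: "h i \<in> int_polys_le d'" if "i < r" for i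
    using h_d' that by blast
  have nonempty: "\<forall>(l, \<kappa>)\<in>set B. dbox n k l \<kappa> \<noteq> {}"
    by (rule SolveCE_rejects_iff(1)[OF run h_le d' start refl])
  have rejected: "R = {(l, \<kappa>) \<in> set B. \<not> all_hasSol p (d_matrix d' r h (box_lo l \<kappa>) (box_hi l \<kappa>))}"
    by (rule SolveCE_rejects_iff(2)[OF run h_le d' start refl])
  have criterion: "all_hasSol p (d_matrix d' r h (box_lo l \<kappa>) (box_hi l \<kappa>)) \<longleftrightarrow>
      (\<exists>l'. dbox n k l' (0\<^sub>v n) \<subseteq> dbox n k l \<kappa> \<and> dbox n k l' (0\<^sub>v n) \<inter> sol_set n r h p \<noteq> {})"
    if "dbox n k l \<kappa> \<noteq> {}" for l \<kappa>
    using equiv[rule_format, OF order.refl that] by blast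
  have "(l, \<kappa>) \<in> R \<longleftrightarrow>
      \<not> (\<exists>l'. dbox n k l' (0\<^sub>v n) \<subseteq> dbox n k l \<kappa> \<and> dbox n k l' (0\<^sub>v n) \<inter> sol_set n r h p \<noteq> {})"
    if b: "(l, \<kappa>) \<in> set B" for l \<kappa>
  proof -
    have ne: "dbox n k l \<kappa> \<noteq> {}" using nonempty b by blast
    have "(l, \<kappa>) \<in> R \<longleftrightarrow> \<not> all_hasSol p (d_matrix d' r h (box_lo l \<kappa>) (box_hi l \<kappa>))"
      unfolding rejected using b by simp
    then show ?thesis by (simp only: criterion[OF ne])
  qed
  then show "\<forall>(l, \<kappa>) \<in> set B. (l, \<kappa>) \<in> R \<longleftrightarrow>
      \<not> (\<exists>l'. dbox n k l' (0\<^sub>v n) \<subseteq> dbox n k l \<kappa> \<and>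
             dbox n k l' (0\<^sub>v n) \<inter> sol_set n r h p \<noteq> {})"
    by (intro ballI case_prodI2) (simp only:)
qed

end
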